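(* Consider the \textsc{Threshold}-$v$ problem in the noisy value model. Fix a set $X$ of $n$ elements with values $v_1,\dots,v_n$ and a value $v$, and let $k_v$ be the number of elements of $X$ with value at least $v$. There is an oblivious algorithm ($\mathbf{Threshold\text{-}v}$) which returns the elements of $X$ with value at least $v$ with correctness probability at least $2/3$, has expected query complexity $O\left(n+n\log(\min\{k_v,n-k_v\})\right)$, and has expected round complexity $O(\log_2^* n\cdot \log\log k_v)$.
   Context: \textsc{Threshold}-$v$ problem: given a set of elements each carrying a value, and a threshold $v$, output exactly the set of elements whose value is at least $v$. Noisy value model: to answer a query about element $i$, the oracle with probability $2/3$ returns the true value of $i$ and with the remaining probability returns an arbitrary (adversarial) value. An algorithm is oblivious if it has no prior knowledge of the multiset of values of the input. Round complexity: number of batches into which the queries can be partitioned so that each batch depends only on answers to previous batches. $\log_2^*(n)$ is the least $i$ with $a_i\le 0$ for $a_0=n$, $a_{j+1}=\log_2 a_j$. *)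

theory Defs
  imports "HOL-Probability.Probability"
begin

text \<open>
  A deterministic query algorithm is a decision tree whose inner nodes issue one batch of queries.
  Elements are labelled by natural numbers, an element may be queried several times within a batch,
  and the subtree is selected by the list of answers to the whole batch, so a batch depends only on
  the answers to earlier batches. A randomized algorithm is a probability distribution on such trees.
\<close>

datatype query_tree =
    Output "nat set"
  | Batch "nat list" "real list \<Rightarrow> query_tree"

primrec queries_within :: "nat set \<Rightarrow> query_tree \<Rightarrow> bool" where
  "queries_within X (Output S) \<longleftrightarrow> True"
| "queries_within X (Batch qs next) \<longleftrightarrow> set qs \<subseteq> X \<and> (\<forall>as. queries_within X (next as))"

text \<open>
  The history records for every earlier batch the queried elements, which of the queries were
  answered truthfully by the oracle's coin, and the answers. The adversary maps the history, the
  current batch and the coins of the current batch to the value it returns at each position whose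
  coin came up false. It may also return the true value. Randomized adversaries are mixtures
  of these, and a bound on a probability or an expectation that holds for every such adversary
  carries over to mixtures.
\<close>

type_synonym history = "(nat list \<times> bool list \<times> real list) list"
type_synonym adversary = "history \<Rightarrow> nat list \<Rightarrow> bool list \<Rightarrow> nat \<Rightarrow> real"

definition noisy_answers ::
  "(nat \<Rightarrow> real) \<Rightarrow> adversary \<Rightarrow> history \<Rightarrow> nat list \<Rightarrow> bool list \<Rightarrow> real list" where
  "noisy_answers val adv h qs cs =
     map (\<lambda>j. if cs ! j then val (qs ! j) else adv h qs cs j) [0..<length qs]"

record outcome =
  result :: "nat set"
  num_queries :: nat
  num_rounds :: nat

primrec run_tree ::
  "(nat \<Rightarrow> real) \<Rightarrow> adversary \<Rightarrow> query_tree \<Rightarrow> history \<Rightarrow> outcome pmf" where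
  "run_tree val adv (Output S) h =
     return_pmf \<lparr>result = S, num_queries = 0, num_rounds = 0\<rparr>"
| "run_tree val adv (Batch qs next) h =
     bind_pmf (replicate_pmf (length qs) (bernoulli_pmf (2/3))) (\<lambda>cs.
       let as = noisy_answers val adv h qs cs in
       map_pmf (\<lambda>r. \<lparr>result = result r,
                     num_queries = length qs + num_queries r,
                     num_rounds = 1 + num_rounds r\<rparr>)
         (run_tree val adv (next as) (h @ [(qs, cs, as)])))"

definition run_alg ::
  "(nat \<Rightarrow> real) \<Rightarrow> adversary \<Rightarrow> query_tree pmf \<Rightarrow> outcome pmf" where
  "run_alg val adv A = bind_pmf A (\<lambda>t. run_tree val adv t [])"

definition expected_queries :: "outcome pmf \<Rightarrow> ennreal" where
  "expected_queries R = (\<integral>\<^sup>+ r. of_nat (num_queries r) \<partial>measure_pmf R)"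

definition expected_rounds :: "outcome pmf \<Rightarrow> ennreal" where
  "expected_rounds R = (\<integral>\<^sup>+ r. of_nat (num_rounds r) \<partial>measure_pmf R)"

definition at_least :: "nat set \<Rightarrow> (nat \<Rightarrow> real) \<Rightarrow> real \<Rightarrow> nat set" where
  "at_least X val v = {x \<in> X. val x \<ge> v}"

definition log2_star :: "real \<Rightarrow> nat" where
  "log2_star x = (LEAST i. (log 2 ^^ i) x \<le> 0)"

end

theory Submission
  imports Defs
begin

text \<open>
  A first batch tells which of the two sides of the threshold is the minority, except with
  probability exponentially small in \<open>n\<close> when the sides are very unbalanced. The elements of this
  side, the target of size \<open>\<kappa>\<close>, are found by filtering: querying each candidate \<open>60 s\<close> times and
  keeping it on a majority vote errs with probability at most \<open>4^-s\<close>, so only a fraction \<open>4^-s\<close> of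
  the wrong candidates survives and the next round can afford \<open>2^s\<close> in place of \<open>s\<close>. After
  \<open>log* n\<close> rounds \<open>s\<close> exceeds \<open>log n\<close> and no wrong candidate is left.

  No knowledge of \<open>\<kappa>\<close> is needed: filtering from a constant \<open>s\<close> already keeps at least half of the
  target, which reveals \<open>\<kappa>\<close> up to a factor of two. A second filtering of the whole set, started at
  \<open>s \<approx> log \<kappa>\<close>, then loses nothing by a union bound over the target. The target itself costs
  \<open>\<kappa> log n = O(n + n log \<kappa>)\<close> queries, and the number of rounds is \<open>O(log* n)\<close> for every \<open>\<kappa>\<close>.
\<close>

section \<open>Truthfulness coins\<close>

definition coin_mean :: "nat \<Rightarrow> (bool list \<Rightarrow> real) \<Rightarrow> real" where
  "coin_mean N f = measure_pmf.expectation (replicate_pmf N (bernoulli_pmf (2/3))) f"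

lemma finite_set_coins: "finite (set_pmf (replicate_pmf N (bernoulli_pmf (2/3))))"
proof -
  have "set_pmf (replicate_pmf N (bernoulli_pmf (2/3))) \<subseteq> {xs. set xs \<subseteq> UNIV \<and> length xs = N}"
    by (auto simp: set_replicate_pmf)
  thus ?thesis by (rule finite_subset) (rule finite_lists_length_eq, simp)
qed

lemma integrable_coins:
  fixes f :: "bool list \<Rightarrow> real"
  shows "integrable (measure_pmf (replicate_pmf N (bernoulli_pmf (2/3)))) f"
  by (rule integrable_measure_pmf_finite[OF finite_set_coins])

lemma coin_mean_mono:
  assumes "\<And>cs. length cs = N \<Longrightarrow> f cs \<le> g cs"
  shows "coin_mean N f \<le> coin_mean N g"
  unfolding coin_mean_def
  by (rule integral_mono_AE[OF integrable_coins integrable_coins])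
     (auto simp: AE_measure_pmf_iff set_replicate_pmf assms)

lemma coin_mean_const [simp]: "coin_mean N (\<lambda>_. c) = c"
  by (simp add: coin_mean_def)

lemma coin_mean_add: "coin_mean N (\<lambda>cs. f cs + g cs) = coin_mean N f + coin_mean N g"
  unfolding coin_mean_def by (rule Bochner_Integration.integral_add[OF integrable_coins integrable_coins])

lemma coin_mean_cmult: "coin_mean N (\<lambda>cs. c * f cs) = c * coin_mean N f"
  unfolding coin_mean_def by simp

lemma coin_mean_sum: "coin_mean N (\<lambda>cs. \<Sum>x\<in>A. f x cs) = (\<Sum>x\<in>A. coin_mean N (f x))"
  unfolding coin_mean_def by (rule Bochner_Integration.integral_sum[OF integrable_coins])

lemma coin_mean_nonneg:
  assumes "\<And>cs. length cs = N \<Longrightarrow> 0 \<le> f cs"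
  shows "0 \<le> coin_mean N f"
  using coin_mean_mono[of N "\<lambda>_. 0" f] assms by simp

lemma nn_integral_coins:
  assumes "\<And>cs. 0 \<le> f cs"
  shows "(\<integral>\<^sup>+cs. ennreal (f cs) \<partial>measure_pmf (replicate_pmf N (bernoulli_pmf (2/3))))
    = ennreal (coin_mean N f)"
  unfolding coin_mean_def using assms by (intro nn_integral_eq_integral[OF integrable_coins]) auto

lemma coin_mean_Suc:
  "coin_mean (Suc N) f =
     2/3 * coin_mean N (\<lambda>cs. f (True # cs)) + 1/3 * coin_mean N (\<lambda>cs. f (False # cs))"
proof -
  have "coin_mean (Suc N) f = measure_pmf.expectation
      (bernoulli_pmf (2/3) \<bind> (\<lambda>c. map_pmf ((#) c) (replicate_pmf N (bernoulli_pmf (2/3))))) f"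
    by (simp add: coin_mean_def map_pmf_def)
  also have "\<dots> = (\<Sum>c\<in>UNIV. pmf (bernoulli_pmf (2/3)) c *\<^sub>R
      measure_pmf.expectation (map_pmf ((#) c) (replicate_pmf N (bernoulli_pmf (2/3)))) f)"
    by (rule pmf_expectation_bind) (auto intro!: finite_set_coins)
  finally show ?thesis by (simp add: UNIV_bool coin_mean_def)
qed

text \<open>Independence of the coins, obtained by peeling off the first coin and recursing on the
  rest.\<close>

lemma coin_mean_prod:
  "coin_mean N (\<lambda>cs. \<Prod>i<N. f i (cs ! i)) = (\<Prod>i<N. 2/3 * f i True + 1/3 * f i False)"
proof (induction N arbitrary: f)
  case 0
  show ?case by (simp add: coin_mean_def)
next
  case (Suc N)
  have "coin_mean (Suc N) (\<lambda>cs. \<Prod>i<Suc N. f i (cs ! i)) =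
     2/3 * (f 0 True * coin_mean N (\<lambda>cs. \<Prod>i<N. f (Suc i) (cs ! i))) +
     1/3 * (f 0 False * coin_mean N (\<lambda>cs. \<Prod>i<N. f (Suc i) (cs ! i)))"
    by (simp add: coin_mean_Suc prod.lessThan_Suc_shift coin_mean_cmult del: prod.lessThan_Suc)
  also have "\<dots> = (2/3 * f 0 True + 1/3 * f 0 False) *
      (\<Prod>i<N. 2/3 * f (Suc i) True + 1/3 * f (Suc i) False)"
    by (simp only: Suc.IH[of "\<lambda>i. f (Suc i)"] ring_distribs mult.assoc)
  finally show ?case by (simp add: prod.lessThan_Suc_shift del: prod.lessThan_Suc)
qed

text \<open>A false coin only permits a wrong answer, since the adversary may still return the true
  value. Counting false coins bounds the number of wrong answers by a quantity that no longer
  involves the adversary.\<close>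

definition lies :: "bool list \<Rightarrow> nat set \<Rightarrow> nat" where
  "lies cs I = card {i \<in> I. \<not> cs ! i}"

text \<open>By independence each position of \<open>I\<close> contributes the factor 2/3 * 1 + 1/3 *
  2 = 4/3.\<close>

lemma coin_mean_two_power_lies:
  assumes "I \<subseteq> {..<N}"
  shows "coin_mean N (\<lambda>cs. 2 ^ lies cs I) = (4/3) ^ card I"
proof -
  have "2 ^ lies cs I = (\<Prod>i<N. if i \<in> I \<and> \<not> cs ! i then 2 else (1::real))" for cs
  proof -
    have "(\<Prod>i<N. if i \<in> I \<and> \<not> cs ! i then 2 else (1::real))
        = (\<Prod>i \<in> {i \<in> {..<N}. i \<in> I \<and> \<not> cs ! i}. 2)"
      by (rule prod.inter_filter[symmetric]) simp
    also have "{i \<in> {..<N}. i \<in> I \<and> \<not> cs ! i} = {i \<in> I. \<not> cs ! i}" using assms by auto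
    finally show ?thesis by (simp add: lies_def)
  qed
  hence "coin_mean N (\<lambda>cs. 2 ^ lies cs I) =
      (\<Prod>i<N. 2/3 * (if i \<in> I \<and> \<not> True then 2 else 1) + 1/3 * (if i \<in> I \<and> \<not> False then 2 else 1))"
    by (simp only: coin_mean_prod[of N "\<lambda>i c. if i \<in> I \<and> \<not> c then 2 else 1"])
  also have "\<dots> = (\<Prod>i<N. if i \<in> I then 4/3 else 1)" by (intro prod.cong) auto
  also have "\<dots> = (\<Prod>i \<in> {i \<in> {..<N}. i \<in> I}. 4/3)"
    by (rule prod.inter_filter[symmetric]) simp
  also have "{i \<in> {..<N}. i \<in> I} = I" using assms by auto
  finally show ?thesis by simp
qed

text \<open>
  Chernoff's argument with the exponential moment of base 2. The constants 60 and 27 are chosen so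
  that \<open>(4/3)^60 / 2^27 \<le> 1/4\<close>.
\<close>

lemma many_lies_unlikely:
  assumes "I \<subseteq> {..<N}" "card I = 60 * s"
  shows "coin_mean N (\<lambda>cs. of_bool (27 * s \<le> lies cs I)) \<le> (1/4) ^ s"
proof -
  have "coin_mean N (\<lambda>cs. of_bool (27 * s \<le> lies cs I))
      \<le> coin_mean N (\<lambda>cs. (1/2) ^ (27 * s) * 2 ^ lies cs I)"
  proof (rule coin_mean_mono)
    fix cs :: "bool list"
    show "of_bool (27 * s \<le> lies cs I) \<le> (1/2) ^ (27 * s) * (2::real) ^ lies cs I"
    proof (cases "27 * s \<le> lies cs I")
      case True
      hence "(2::real) ^ (27 * s) \<le> 2 ^ lies cs I" by (intro power_increasing) auto
      thus ?thesis using True by (simp add: power_divide)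
    qed simp
  qed
  also have "\<dots> = (1/2) ^ (27 * s) * (4/3) ^ (60 * s)"
    by (simp add: coin_mean_cmult coin_mean_two_power_lies[OF assms(1)] assms(2))
  also have "\<dots> = ((1/2) ^ 27 * (4/3) ^ 60) ^ s" by (simp add: power_mult power_mult_distrib)
  also have "\<dots> \<le> (1/4) ^ s" by (intro power_mono) (simp_all add: power_divide)
  finally show ?thesis .
qed

section \<open>Expected cost of a decision tree\<close>

text \<open>
  The parameters \<open>\<alpha>\<close>, \<open>\<beta>\<close>, \<open>\<gamma>\<close> are the prices of an output other than \<open>G\<close>, of a query, and of a
  round, so one recursion bounds error probability, expected queries and expected rounds.
\<close>

primrec tree_cost :: "real \<Rightarrow> real \<Rightarrow> real \<Rightarrow> nat set \<Rightarrow> (nat \<Rightarrow> real) \<Rightarrow> adversary \<Rightarrow>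
    query_tree \<Rightarrow> history \<Rightarrow> real" where
  "tree_cost \<alpha> \<beta> \<gamma> G val adv (Output S) h = \<alpha> * of_bool (S \<noteq> G)"
| "tree_cost \<alpha> \<beta> \<gamma> G val adv (Batch qs next) h =
     \<beta> * length qs + \<gamma> + coin_mean (length qs) (\<lambda>cs.
       let as = noisy_answers val adv h qs cs in
       tree_cost \<alpha> \<beta> \<gamma> G val adv (next as) (h @ [(qs, cs, as)]))"

lemma tree_cost_nonneg:
  assumes "0 \<le> \<alpha>" "0 \<le> \<beta>" "0 \<le> \<gamma>"
  shows "0 \<le> tree_cost \<alpha> \<beta> \<gamma> G val adv t h"
  using assms by (induction t arbitrary: h) (auto simp: Let_def intro!: add_nonneg_nonneg coin_mean_nonneg)

lemma tree_cost_error_le_1: "tree_cost 1 0 0 G val adv t h \<le> 1"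
proof (induction t arbitrary: h)
  case (Batch qs nx)
  have "tree_cost 1 0 0 G val adv (Batch qs nx) h \<le> coin_mean (length qs) (\<lambda>_. 1)"
    unfolding tree_cost.simps Let_def by (simp del: coin_mean_const, rule coin_mean_mono, rule Batch, simp)
  thus ?case by simp
qed simp

text \<open>Induction on the tree: the first batch has a fixed price and the rest of the run is
  averaged over its coins. This reduces integrals over outcomes to a real-valued recursion over
  finitely many coin lists.\<close>

lemma nn_integral_run_tree_le:
  fixes \<alpha> \<beta> \<gamma> :: real
  assumes "0 \<le> \<alpha>" "0 \<le> \<beta>" "0 \<le> \<gamma>"
  shows "(\<integral>\<^sup>+r. ennreal (\<alpha> * of_bool (result r \<noteq> G) + \<beta> * num_queries r + \<gamma> * num_rounds r)
      \<partial>measure_pmf (run_tree val adv t h)) \<le> ennreal (tree_cost \<alpha> \<beta> \<gamma> G val adv t h)"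
proof (induction t arbitrary: h)
  case (Output S)
  thus ?case by simp
next
  case (Batch qs nx)
  let ?as = "noisy_answers val adv h qs"
  let ?h = "\<lambda>cs. h @ [(qs, cs, ?as cs)]"
  let ?J = "\<lambda>cs. tree_cost \<alpha> \<beta> \<gamma> G val adv (nx (?as cs)) (?h cs)"
  let ?w = "\<lambda>r. \<alpha> * of_bool (result r \<noteq> G) + \<beta> * num_queries r + \<gamma> * num_rounds r"
  let ?c = "\<beta> * length qs + \<gamma>"
  note J0 = tree_cost_nonneg[OF assms]
  have "(\<integral>\<^sup>+r. ennreal (?w r) \<partial>measure_pmf (run_tree val adv (Batch qs nx) h))
     = (\<integral>\<^sup>+cs. \<integral>\<^sup>+r. ennreal (?c + ?w r) \<partial>measure_pmf (run_tree val adv (nx (?as cs)) (?h cs))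
         \<partial>measure_pmf (replicate_pmf (length qs) (bernoulli_pmf (2/3))))"
    by (simp add: Let_def algebra_simps)
  also have "\<dots> = (\<integral>\<^sup>+cs. ennreal ?c + (\<integral>\<^sup>+r. ennreal (?w r) \<partial>measure_pmf (run_tree val adv (nx (?as cs)) (?h cs)))
         \<partial>measure_pmf (replicate_pmf (length qs) (bernoulli_pmf (2/3))))"
    using assms by (simp add: nn_integral_add)
  also have "\<dots> \<le> (\<integral>\<^sup>+cs. ennreal ?c + ennreal (?J cs)
         \<partial>measure_pmf (replicate_pmf (length qs) (bernoulli_pmf (2/3))))"
    by (intro nn_integral_mono add_left_mono Batch) simp
  also have "\<dots> = (\<integral>\<^sup>+cs. ennreal (?c + ?J cs)
         \<partial>measure_pmf (replicate_pmf (length qs) (bernoulli_pmf (2/3))))"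
    using assms J0 by simp
  also have "\<dots> = ennreal (coin_mean (length qs) (\<lambda>cs. ?c + ?J cs))"
    using assms J0 by (intro nn_integral_coins) simp
  finally show ?case by (simp add: coin_mean_add Let_def)
qed

section \<open>Filtering a candidate set\<close>

definition batch :: "nat \<Rightarrow> nat set \<Rightarrow> nat list" where
  "batch s S = concat (replicate (60 * s) (sorted_list_of_set S))"

text \<open>A strict majority of the \<open>60 * s\<close> votes on each candidate; a tie
  rejects.\<close>

definition keep :: "(real \<Rightarrow> bool) \<Rightarrow> nat \<Rightarrow> nat set \<Rightarrow> real list \<Rightarrow> nat set" where
  "keep P s S as = {x \<in> S. 30 * s <
     card {j. j < length (batch s S) \<and> batch s S ! j = x \<and> P (as ! j)}}"

text \<open>Continuation style: \<open>rest\<close> receives the surviving set, so filterings can be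
  chained.\<close>

primrec filter_tree :: "(real \<Rightarrow> bool) \<Rightarrow> nat list \<Rightarrow> nat set \<Rightarrow> (nat set \<Rightarrow> query_tree) \<Rightarrow>
    query_tree" where
  "filter_tree P [] S rest = rest S"
| "filter_tree P (s # ms) S rest =
     Batch (batch s S) (\<lambda>as. filter_tree P ms (keep P s S as) rest)"

lemma card_batch_positions:
  assumes "finite S"
  shows "card {j. j < length (batch s S) \<and> P (batch s S ! j)} = 60 * s * card {x \<in> S. P x}"
proof -
  have concat: "length (filter P (concat (replicate m xs))) = m * length (filter P xs)" for m xs
    by (induction m) auto
  have "card {j. j < length (batch s S) \<and> P (batch s S ! j)} = length (filter P (batch s S))"
    by (simp add: length_filter_conv_card)
  also have "\<dots> = 60 * s * card (set (filter P (sorted_list_of_set S)))"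
    by (simp add: batch_def concat distinct_card del: set_filter)
  finally show ?thesis using assms by simp
qed

lemma length_batch: "finite S \<Longrightarrow> length (batch s S) = 60 * s * card S"
  using card_batch_positions[of S s "\<lambda>_. True"] by simp

lemma set_batch_subset: "finite S \<Longrightarrow> set (batch s S) \<subseteq> S"
  by (auto simp: batch_def)

lemma keep_subset: "keep P s S as \<subseteq> S"
  by (auto simp: keep_def)

lemma queries_within_filter_tree:
  assumes "finite X" "S \<subseteq> X" "\<And>S'. S' \<subseteq> X \<Longrightarrow> queries_within X (rest S')"
  shows "queries_within X (filter_tree P ms S rest)"
  using assms(2)
proof (induction ms arbitrary: S)
  case (Cons s ms)
  have "finite S" using Cons.prems assms(1) finite_subset by blast
  thus ?case using Cons.IH Cons.prems keep_subset[of P s S] set_batch_subset[of S s]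
    by (auto intro!: Cons.IH)
qed (use assms in simp)

lemma nth_noisy_answers:
  "j < length qs \<Longrightarrow>
    noisy_answers val adv h qs cs ! j = (if cs ! j then val (qs ! j) else adv h qs cs j)"
  by (simp add: noisy_answers_def)

text \<open>A wrong verdict on \<open>60 * s\<close> votes needs at least \<open>30 * s\<close>
  false coins, which exceeds the level at which the tail bound applies.\<close>

lemma misclassified_lies:
  assumes "finite S" "x \<in> S"
    and wrong: "x \<in> keep P s S (noisy_answers val adv h (batch s S) cs) \<longleftrightarrow> \<not> P (val x)"
  shows "27 * s \<le> lies cs {j. j < length (batch s S) \<and> batch s S ! j = x}"
proof -
  let ?qs = "batch s S"
  let ?as = "noisy_answers val adv h ?qs cs"
  let ?I = "{j. j < length ?qs \<and> ?qs ! j = x}"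
  let ?V = "{j. j < length ?qs \<and> ?qs ! j = x \<and> P (?as ! j)}"
  let ?F = "{j \<in> ?I. \<not> cs ! j}"
  have "{y \<in> S. y = x} = {x}" using assms(2) by auto
  hence I: "card ?I = 60 * s"
    using card_batch_positions[OF assms(1), of s "\<lambda>y. y = x"] by simp
  have fin: "finite ?F" "finite ?V" by auto
  have K: "x \<in> keep P s S ?as \<longleftrightarrow> 30 * s < card ?V" using assms(2) by (simp add: keep_def)
  show ?thesis
  proof (cases "P (val x)")
    case True
    have "?I \<subseteq> ?V \<union> ?F" using True by (auto simp: nth_noisy_answers)
    hence "card ?I \<le> card ?V + card ?F"
      using fin by (meson card_Un_le card_mono finite_UnI order_trans)
    thus ?thesis using K wrong True I by (simp add: lies_def)
  next
    case False
    have "?V \<subseteq> ?F" using False by (auto simp: nth_noisy_answers split: if_splits)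
    hence "card ?V \<le> card ?F" using fin card_mono by blast
    thus ?thesis using K wrong False by (simp add: lies_def)
  qed
qed

text \<open>Linearity of expectation over the candidates, each with \<open>60 * s\<close> positions
  of its own. The events concern coins alone, so adversarial answers correlated across candidates do
  no harm.\<close>

lemma coin_mean_sum_misclassified_le:
  assumes "finite S" "A \<subseteq> S"
  shows "coin_mean (length (batch s S))
      (\<lambda>cs. \<Sum>x\<in>A. of_bool (27 * s \<le> lies cs {j. j < length (batch s S) \<and> batch s S ! j = x}))
    \<le> (1/4) ^ s * card A"
proof -
  have "coin_mean (length (batch s S))
      (\<lambda>cs. of_bool (27 * s \<le> lies cs {j. j < length (batch s S) \<and> batch s S ! j = x})) \<le> (1/4) ^ s"
    if "x \<in> A" for x
  proof (rule many_lies_unlikely)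
    have "{y \<in> S. y = x} = {x}" using that assms(2) by auto
    thus "card {j. j < length (batch s S) \<and> batch s S ! j = x} = 60 * s"
      using card_batch_positions[OF assms(1), of s "\<lambda>y. y = x"] by simp
  qed auto
  thus ?thesis unfolding coin_mean_sum
    using sum_bounded_above[of A _ "(1/4::real) ^ s"] by (simp add: mult.commute)
qed

text \<open>Bounds the expected price caused by one wrong candidate: \<open>60 * s\<close> queries
  now, then with probability at most 4^-s the price of the remaining rounds, and \<open>B\<close> if
  it survives them all.\<close>

primrec false_price :: "real \<Rightarrow> real \<Rightarrow> nat list \<Rightarrow> real" where
  "false_price \<beta> B [] = B"
| "false_price \<beta> B (s # ms) = 60 * \<beta> * s + (1/4) ^ s * false_price \<beta> B ms"

lemma false_price_nonneg: "0 \<le> \<beta> \<Longrightarrow> 0 \<le> B \<Longrightarrow> 0 \<le> false_price \<beta> B ms"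
  by (induction ms) auto

context
  fixes val :: "nat \<Rightarrow> real" and adv :: adversary and P :: "real \<Rightarrow> bool" and X :: "nat set"
  assumes finX: "finite X"
begin

abbreviation (input) target :: "nat set" where
  "target \<equiv> {x \<in> X. P (val x)}"

lemma coin_mean_false_kept_le:
  assumes "S \<subseteq> X"
  shows "coin_mean (length (batch s S))
      (\<lambda>cs. real (card (keep P s S (noisy_answers val adv h (batch s S) cs) - target)))
    \<le> (1/4) ^ s * card (S - target)"
proof -
  have fin: "finite S" using assms finX finite_subset by blast
  let ?K = "\<lambda>cs. keep P s S (noisy_answers val adv h (batch s S) cs)"
  let ?b = "\<lambda>cs x. 27 * s \<le> lies cs {j. j < length (batch s S) \<and> batch s S ! j = x}"
  have "real (card (?K cs - target)) \<le> (\<Sum>x\<in>S - target. of_bool (?b cs x))" for cs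
  proof -
    have "?K cs - target \<subseteq> {x \<in> S - target. ?b cs x}"
      using assms misclassified_lies[OF fin] keep_subset[of P s S] by blast
    hence "card (?K cs - target) \<le> card {x \<in> S - target. ?b cs x}" using fin by (intro card_mono) auto
    thus ?thesis using fin by (simp add: Int_def)
  qed
  hence "coin_mean (length (batch s S)) (\<lambda>cs. real (card (?K cs - target)))
     \<le> coin_mean (length (batch s S)) (\<lambda>cs. \<Sum>x\<in>S - target. of_bool (?b cs x))"
    by (intro coin_mean_mono)
  also have "\<dots> \<le> (1/4) ^ s * card (S - target)"
    using coin_mean_sum_misclassified_le[OF fin, of "S - target"] by blast
  finally show ?thesis .
qed

text \<open>A target element is missing afterwards only if it was missing before or is misclassified
  now.\<close>

lemma coin_mean_lost_le:
  assumes "S \<subseteq> X"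
  shows "coin_mean (length (batch s S))
      (\<lambda>cs. real (card (target - keep P s S (noisy_answers val adv h (batch s S) cs))))
    \<le> card (target - S) + (1/4) ^ s * card target"
proof -
  have fin: "finite S" using assms finX finite_subset by blast
  let ?K = "\<lambda>cs. keep P s S (noisy_answers val adv h (batch s S) cs)"
  let ?b = "\<lambda>cs x. 27 * s \<le> lies cs {j. j < length (batch s S) \<and> batch s S ! j = x}"
  have "real (card (target - ?K cs)) \<le> real (card (target - S)) + (\<Sum>x\<in>S \<inter> target. of_bool (?b cs x))" for cs
  proof -
    have "target - ?K cs \<subseteq> (target - S) \<union> {x \<in> S \<inter> target. ?b cs x}"
      using assms misclassified_lies[OF fin] by blast
    hence "card (target - ?K cs) \<le> card ((target - S) \<union> {x \<in> S \<inter> target. ?b cs x})"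
      using fin finX by (intro card_mono) auto
    also have "\<dots> \<le> card (target - S) + card {x \<in> S \<inter> target. ?b cs x}" by (rule card_Un_le)
    finally show ?thesis using fin by (simp add: Int_def)
  qed
  hence "coin_mean (length (batch s S)) (\<lambda>cs. real (card (target - ?K cs)))
     \<le> coin_mean (length (batch s S)) (\<lambda>cs. real (card (target - S)) + (\<Sum>x\<in>S \<inter> target. of_bool (?b cs x)))"
    by (intro coin_mean_mono)
  also have "\<dots> \<le> card (target - S) + (1/4) ^ s * card (S \<inter> target)"
    unfolding coin_mean_add using coin_mean_sum_misclassified_le[OF fin, of "S \<inter> target"] by simp
  also have "\<dots> \<le> card (target - S) + (1/4) ^ s * card target"
    using finX by (intro add_left_mono mult_left_mono) (auto intro!: card_mono)
  finally show ?thesis .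
qed

text \<open>Induction over the rounds with a potential linear in the wrong candidates and in the
  lost target elements, so that expectations suffice although the surviving set is random.
  \<open>B\<close> and \<open>D\<close> are what the continuation charges per wrong survivor and per
  lost target element. Target elements are charged as if queried in every round.\<close>

lemma tree_cost_filter_tree_le:
  fixes \<alpha> \<beta> \<gamma> A B D :: real
  assumes nonneg: "0 \<le> \<beta>" "0 \<le> B" "0 \<le> D"
    and rest: "\<And>S' h'. S' \<subseteq> X \<Longrightarrow> tree_cost \<alpha> \<beta> \<gamma> G val adv (rest S') h'
      \<le> A + B * card (S' - target) + D * card (target - S')"
    and "S \<subseteq> X"
  shows "tree_cost \<alpha> \<beta> \<gamma> G val adv (filter_tree P ms S rest) h
    \<le> A + false_price \<beta> B ms * card (S - target)
        + D * (card (target - S) + card target * (\<Sum>s\<leftarrow>ms. (1/4) ^ s))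
        + 60 * \<beta> * card target * real (sum_list ms) + \<gamma> * length ms"
  using \<open>S \<subseteq> X\<close>
proof (induction ms arbitrary: S h)
  case Nil
  thus ?case using rest by simp
next
  case (Cons s ms)
  have fin: "finite S" using Cons.prems finX finite_subset by blast
  let ?qs = "batch s S"
  let ?as = "noisy_answers val adv h ?qs"
  let ?K = "\<lambda>cs. keep P s S (?as cs)"
  let ?g = "false_price \<beta> B ms"
  let ?l = "\<Sum>s\<leftarrow>ms. (1/4::real) ^ s"
  let ?c = "A + D * (card target * ?l) + 60 * \<beta> * card target * real (sum_list ms) + \<gamma> * length ms"
  have g0: "0 \<le> ?g" using nonneg false_price_nonneg by auto
  have "coin_mean (length ?qs) (\<lambda>cs. tree_cost \<alpha> \<beta> \<gamma> G val adv
           (filter_tree P ms (?K cs) rest) (h @ [(?qs, cs, ?as cs)]))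
     \<le> coin_mean (length ?qs) (\<lambda>cs. ?c + (?g * card (?K cs - target) + D * card (target - ?K cs)))"
  proof (rule coin_mean_mono)
    fix cs
    have "?K cs \<subseteq> X" using keep_subset Cons.prems by blast
    from Cons.IH[OF this] show "tree_cost \<alpha> \<beta> \<gamma> G val adv
           (filter_tree P ms (?K cs) rest) (h @ [(?qs, cs, ?as cs)])
         \<le> ?c + (?g * card (?K cs - target) + D * card (target - ?K cs))"
      by (rule order_trans) (simp add: algebra_simps)
  qed
  also have "\<dots> = ?c + (?g * coin_mean (length ?qs) (\<lambda>cs. card (?K cs - target))
      + D * coin_mean (length ?qs) (\<lambda>cs. card (target - ?K cs)))"
    by (simp only: coin_mean_add coin_mean_cmult coin_mean_const)
  also have "\<dots> \<le> ?c + (?g * ((1/4) ^ s * card (S - target))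
      + D * (card (target - S) + (1/4) ^ s * card target))"
    using g0 nonneg Cons.prems
    by (intro add_left_mono add_mono mult_left_mono coin_mean_false_kept_le coin_mean_lost_le)
  finally have 1: "tree_cost \<alpha> \<beta> \<gamma> G val adv (filter_tree P (s # ms) S rest) h
     \<le> \<beta> * length ?qs + \<gamma> + (?c + (?g * ((1/4) ^ s * card (S - target))
      + D * (card (target - S) + (1/4) ^ s * card target)))"
    by (simp add: Let_def)
  \<comment> \<open>Queries on wrong candidates go into \<open>false_price\<close>, those on true
    ones into the term with \<open>sum_list ms\<close>.\<close>
  have "card S \<le> card ((S - target) \<union> target)" using fin finX by (intro card_mono) auto
  also have "\<dots> \<le> card (S - target) + card target" by (rule card_Un_le)
  finally have "length ?qs \<le> 60 * s * (card (S - target) + card target)"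
    by (simp add: length_batch[OF fin])
  hence "real (length ?qs) \<le> real (60 * s * (card (S - target) + card target))"
    by (rule of_nat_mono)
  hence "real (length ?qs) \<le> 60 * s * (real (card (S - target)) + card target)" by simp
  hence "\<beta> * length ?qs \<le> \<beta> * (60 * s * (real (card (S - target)) + card target))"
    using nonneg by (intro mult_left_mono)
  thus ?case using 1 by (simp add: algebra_simps)
qed

end

section \<open>The tower schedule\<close>

text \<open>A tower of exponentials. The last entry is always at least \<open>L\<close>, which makes
  wrong survivors rare; the cap keeps the entries reached by a jump from exceeding
  \<open>L\<close>.\<close>

function schedule :: "nat \<Rightarrow> nat \<Rightarrow> nat list" where
  "schedule L s = (if L \<le> s then [s] else s # schedule L (min L (2 ^ s)))"
  by auto
termination
  by (relation "Wellfounded.measure (\<lambda>(L, s). L - s)") (auto simp: min_def intro: diff_less_mono2)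

declare schedule.simps [simp del]

text \<open>Entries at least double until the cap is reached, so the sum is of geometric
  type.\<close>

lemma sum_list_schedule_le:
  assumes "1 \<le> s"
  shows "sum_list (schedule L s) \<le> 3 * L + s"
proof -
  \<comment> \<open>The extra \<open>s\<close> drives the induction: a jump to 2^s \<ge> 2 s pays
    for both copies of \<open>s\<close>, and a capped jump leaves only the entry
    \<open>L\<close>.\<close>
  have "sum_list (schedule L s) + s \<le> 3 * L" if "1 \<le> s" "s \<le> L" for L s
    using that
  proof (induction L s rule: schedule.induct)
    case (1 L s)
    show ?case
    proof (cases "L \<le> s")
      case True
      thus ?thesis using 1 by (simp add: schedule.simps)
    next
      case False
      have "2 * s \<le> 2 ^ s" using \<open>1 \<le> s\<close>
        by (induction s rule: dec_induct) auto
      moreover have "sum_list (schedule L (min L (2 ^ s))) + min L (2 ^ s) \<le> 3 * L"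
        using False 1 by (intro 1) auto
      moreover have "schedule L L = [L]" by (simp add: schedule.simps)
      ultimately show ?thesis using False
        by (subst schedule.simps) (auto simp: min_def split: if_splits)
    qed
  qed
  from this[of s L] show ?thesis using assms
    by (cases "s \<le> L") (auto simp: schedule.simps[of L s])
qed

text \<open>The entries increase strictly before the end, so the terms drop by a factor of at least
  4 each round. This is the union bound over the rounds for losing one target element.\<close>

lemma sum_list_quarter_power_schedule_le: "(\<Sum>i\<leftarrow>schedule L s. (1/4::real) ^ i) \<le> 2 * (1/4) ^ s"
proof (induction L s rule: schedule.induct)
  case (1 L s)
  show ?case
  proof (cases "L \<le> s")
    case True
    thus ?thesis by (simp add: schedule.simps)
  next
    case False
    have "Suc s \<le> 2 ^ s" by (simp add: Suc_leI)
    hence "Suc s \<le> min L (2 ^ s)" using False by simp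
    hence "(1/4::real) ^ min L (2 ^ s) \<le> (1/4) ^ Suc s" by (rule power_decreasing) auto
    moreover have "(0::real) \<le> (1/4) ^ s" by simp
    moreover have "(\<Sum>i\<leftarrow>schedule L s. (1/4::real) ^ i) =
        (1/4) ^ s + (\<Sum>i\<leftarrow>schedule L (min L (2 ^ s)). (1/4) ^ i)"
      using False by (simp add: schedule.simps[of L s])
    ultimately show ?thesis using 1[OF False] by (simp only: power_Suc)
  qed
qed

text \<open>The next round has at most 2^s in place of \<open>s\<close> but is reached with
  probability at most 4^-s, and 4^-s (2^s + 1) \<le> 1. So all rounds after the first cost no more
  than one extra unit of \<open>s\<close>, while the last entry damps \<open>B\<close>.\<close>

lemma false_price_schedule_le:
  assumes "0 \<le> \<beta>" "0 \<le> B" "1 \<le> s"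
  shows "false_price \<beta> B (schedule L s) \<le> 60 * \<beta> * (s + 1) + B * (1/4) ^ L"
  using assms(3)
proof (induction L s rule: schedule.induct)
  case (1 L s)
  show ?case
  proof (cases "L \<le> s")
    case True
    hence "(1/4::real) ^ s \<le> (1/4) ^ L" by (intro power_decreasing) auto
    hence "B * (1/4) ^ s \<le> B * (1/4) ^ L" using assms by (intro mult_left_mono)
    thus ?thesis using True assms by (simp add: schedule.simps algebra_simps)
  next
    case False
    let ?m = "min L (2 ^ s)"
    let ?e = "(1/4::real) ^ s"
    have e: "0 \<le> ?e" "?e \<le> 1" by (auto intro: power_le_one)
    have m1: "real ?m \<le> 2 ^ s"
      by (metis min.cobounded2 of_nat_le_iff of_nat_power of_nat_numeral)
    have "(2::real) ^ s \<ge> 2" using \<open>1 \<le> s\<close> self_le_power[of "2::real" s] by simp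
    moreover from this have "(2::real) ^ s * 2 \<le> 2 ^ s * 2 ^ s" by (intro mult_left_mono) auto
    ultimately have "(2::real) ^ s + 1 \<le> 2 ^ s * 2 ^ s" by linarith
    also have "\<dots> = 4 ^ s" by (simp flip: power_mult_distrib)
    finally have "real ?m + 1 \<le> 4 ^ s" using m1 by linarith
    hence "?e * (real ?m + 1) \<le> ?e * 4 ^ s" using e by (intro mult_left_mono)
    hence e1: "?e * (real ?m + 1) \<le> 1" by (simp flip: power_mult_distrib)
    have "false_price \<beta> B (schedule L ?m) \<le> 60 * \<beta> * (?m + 1) + B * (1/4) ^ L"
      using False 1 by (intro 1) auto
    hence "?e * false_price \<beta> B (schedule L ?m) \<le> ?e * (60 * \<beta> * (?m + 1) + B * (1/4) ^ L)"
      using e by (intro mult_left_mono) auto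
    also have "\<dots> = 60 * \<beta> * (?e * (real ?m + 1)) + ?e * (B * (1/4) ^ L)" by (simp add: algebra_simps)
    also have "\<dots> \<le> 60 * \<beta> * 1 + 1 * (B * (1/4) ^ L)"
      using e e1 assms by (intro add_mono mult_left_mono mult_right_mono) auto
    finally show ?thesis using False by (subst schedule.simps) (simp add: algebra_simps)
  qed
qed

abbreviation tower :: "nat \<Rightarrow> nat \<Rightarrow> nat" where
  "tower i \<equiv> (\<lambda>a. 2 ^ a) ^^ i"

lemma length_schedule_le:
  "L \<le> tower i s \<Longrightarrow> length (schedule L s) \<le> Suc i"
proof (induction i arbitrary: s)
  case 0
  thus ?case by (simp add: schedule.simps)
next
  case (Suc i)
  show ?case
  proof (cases "L \<le> 2 ^ s")
    case True
    hence "min L (2 ^ s) = L" by simp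
    thus ?thesis by (simp add: schedule.simps[of L s] schedule.simps[of L L])
  next
    case False
    have "length (schedule L (2 ^ s)) \<le> Suc i"
      using Suc.prems by (intro Suc.IH) (simp add: funpow_swap1)
    thus ?thesis using False by (subst schedule.simps) (auto simp: min_def)
  qed
qed

lemma le_tower_if_iterated_log_le_0:
  fixes x :: real
  shows "(log 2 ^^ i) x \<le> 0 \<Longrightarrow> x \<le> real (tower i 0)"
proof (induction i arbitrary: x)
  case (Suc i)
  hence "log 2 x \<le> real (tower i 0)" by (simp add: funpow_swap1)
  hence "x \<le> 2 powr real (tower i 0)" if "x > 0"
    using that by (simp add: log_le_iff)
  \<comment> \<open>For x \<le> 0 the logarithm carries no information; there the bound holds
    because the tower is nonnegative.\<close>
  thus ?case by (cases "x > 0") (auto simp: powr_realpow intro: order_trans[of x 0])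
qed simp

text \<open>The \<open>LEAST\<close> is attained: a logarithm lowers a natural upper bound of a
  positive \<open>x\<close> by one, because m + 1 \<le> 2^m.\<close>

lemma iterated_log_log2_star_le_0: "(log 2 ^^ log2_star x) x \<le> 0"
proof -
  have ex: "\<exists>i. (log 2 ^^ i) x \<le> 0" if "x \<le> real m" for m x
    using that
  proof (induction m arbitrary: x)
    case 0
    thus ?case by (intro exI[of _ 0]) simp
  next
    case (Suc m)
    show ?case
    proof (cases "x \<le> 0")
      case True
      thus ?thesis by (intro exI[of _ 0]) simp
    next
      case False
      have "real (Suc m) \<le> 2 ^ m"
        by (metis Suc_leI less_exp of_nat_le_iff of_nat_numeral of_nat_power)
      hence "log 2 x \<le> real m" using Suc.prems False by (simp add: log_le_iff powr_realpow)
      then obtain i where "(log 2 ^^ i) (log 2 x) \<le> 0" using Suc.IH by blast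
      thus ?thesis by (intro exI[of _ "Suc i"]) (simp add: funpow_swap1)
    qed
  qed
  obtain m where "x \<le> real m" using real_arch_simple by blast
  from ex[OF this] show ?thesis unfolding log2_star_def by (rule LeastI_ex)
qed

text \<open>A tower started at 3 or above stays ahead of the one started at 0 by 3 at every height,
  which absorbs the summand 3.\<close>

lemma length_schedule_le_log2_star:
  assumes "L \<le> n + 3" "3 \<le> s"
  shows "length (schedule L s) \<le> Suc (log2_star (real n))"
proof (rule length_schedule_le)
  have tower: "tower i 0 + 3 \<le> tower i s" for i
  proof (induction i)
    case (Suc i)
    have "(2::nat) ^ a + 3 \<le> 2 ^ (a + 3)" for a by (induction a) (auto simp: power_add)
    also have "(2::nat) ^ (tower i 0 + 3) \<le> 2 ^ (tower i s)"
      using Suc by (intro power_increasing) auto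
    finally show ?case by simp
  qed (use assms in simp)
  have "n \<le> tower (log2_star (real n)) 0"
    using le_tower_if_iterated_log_le_0[OF iterated_log_log2_star_le_0[of "real n"]] by simp
  thus "L \<le> tower (log2_star (real n)) s" using assms(1) tower[of "log2_star (real n)"] by linarith
qed

section \<open>The algorithm\<close>

definition lg :: "nat \<Rightarrow> nat" where
  "lg x = (LEAST l. x < 2 ^ l)"

lemma less_two_power_lg: "x < 2 ^ lg x"
  unfolding lg_def by (rule LeastI) (rule less_exp)

lemma lg_le: "x < 2 ^ l \<Longrightarrow> lg x \<le> l"
  unfolding lg_def by (rule Least_le)

lemma lg_mono: "x \<le> y \<Longrightarrow> lg x \<le> lg y"
  using less_two_power_lg[of y] by (intro lg_le) simp

text \<open>From a + b < (a + 1) (b + 1). It lets wrong survivors of the first filtering enter the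
  second starting value only additively.\<close>

lemma lg_add_le: "lg (a + b) \<le> lg a + b"
proof (rule lg_le)
  have "Suc a \<le> 2 ^ lg a" using less_two_power_lg by (simp add: Suc_leI)
  moreover have "Suc b \<le> 2 ^ b" by (simp add: Suc_leI)
  ultimately have "Suc a * Suc b \<le> 2 ^ lg a * 2 ^ b" by (rule mult_le_mono)
  thus "a + b < 2 ^ (lg a + b)" by (simp add: power_add)
qed

lemma lg_le_log: "real (lg x) \<le> 1 + log 2 (max 1 (real x))"
proof (cases "x = 0")
  case True
  have "lg 0 \<le> 0" by (rule lg_le) simp
  thus ?thesis using True by simp
next
  case False
  show ?thesis
  proof (cases "lg x")
    case (Suc l)
    hence "\<not> x < 2 ^ l" using lg_le[of x l] by auto
    hence "(2::real) ^ l \<le> real x"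
      by (metis linorder_not_less of_nat_le_iff of_nat_numeral of_nat_power)
    hence "real l \<le> log 2 (real x)" using False by (simp add: le_log_iff powr_realpow)
    thus ?thesis using False Suc by (simp add: max_def)
  qed simp
qed

lemma log2_le_self:
  fixes x :: real
  assumes "0 < x"
  shows "log 2 x \<le> x"
proof -
  have "ln (1/2::real) \<le> 1/2 - 1" by (rule ln_le_minus_one) simp
  hence half: "1/2 \<le> ln (2::real)" by (simp add: ln_div)
  \<comment> \<open>The tangent of \<open>ln\<close> at 2, whose slope 1/2 is at most
    \<open>ln 2\<close>.\<close>
  have "ln (x / 2) \<le> x / 2 - 1" using assms by (intro ln_le_minus_one) simp
  hence "ln x \<le> x * (1/2) - 1 + ln 2" using assms by (simp add: ln_div)
  also have "\<dots> \<le> x * (1/2)" using ln_le_minus_one[of "2::real"] by simp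
  also have "\<dots> \<le> x * ln 2" using half assms by (intro mult_left_mono) auto
  finally show ?thesis by (simp add: log_def field_simps)
qed

text \<open>Pays for querying a target of size m about log n times: m log n = m log m + m log (n/m),
  and the last term is at most n since log y \<le> y.\<close>

lemma mult_lg_le:
  assumes "m \<le> n"
  shows "real m * lg n \<le> 2 * n + n * log 2 (max 1 (real m))"
proof (cases "m = 0")
  case False
  hence pos: "0 < real m" "0 < real n" using assms by auto
  have "log 2 (n / m) \<le> real n / m" using pos by (intro log2_le_self) simp
  hence "m * log 2 (n / m) \<le> real m * (real n / m)" using pos by (intro mult_left_mono) auto
  hence 1: "m * log 2 n \<le> real n + m * log 2 m" using pos by (simp add: log_divide algebra_simps)
  have "real m * lg n \<le> m * (1 + log 2 (max 1 (real n)))"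
    by (intro mult_left_mono lg_le_log) auto
  also have "max 1 (real n) = n" using pos by simp
  also have "m * (1 + log 2 n) \<le> m + (real n + m * log 2 m)" using 1 by (simp add: algebra_simps)
  also have "\<dots> \<le> n + (real n + n * log 2 m)"
    using assms pos by (intro add_mono mult_right_mono) auto
  finally show ?thesis using pos by (simp add: max_def)
qed (use lg_le_log[of 0] in simp)

text \<open>The second filtering restarts from all of \<open>X\<close>, so target elements lost by
  the first are back; only the number of first survivors is used, to choose the starting
  value.\<close>

definition identify_tree ::
    "(real \<Rightarrow> bool) \<Rightarrow> nat \<Rightarrow> nat set \<Rightarrow> (nat set \<Rightarrow> query_tree) \<Rightarrow> query_tree" where
  "identify_tree P L X out = filter_tree P (schedule L 3) X
     (\<lambda>S. filter_tree P (schedule L (3 + lg (card S))) X out)"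

text \<open>\<open>b\<close> holds when fewer than half of the 60 n answers reach \<open>v\<close>,
  so that the upper side is presumed the minority; otherwise the lower side is identified and
  complemented. The empty set is answered without any round because \<open>log2_star 0\<close> is
  0.\<close>

definition threshold_tree :: "nat set \<Rightarrow> real \<Rightarrow> query_tree" where
  "threshold_tree X v = (if X = {} then Output {} else
     Batch (batch 1 X) (\<lambda>as.
       let b = (card {j. j < length (batch 1 X) \<and> v \<le> as ! j} < 30 * card X)
       in identify_tree (\<lambda>a. (v \<le> a) = b) (lg (card X) + 2) X
            (\<lambda>S. Output (if b then S else X - S))))"

lemma queries_within_threshold_tree:
  assumes "finite X"
  shows "queries_within X (threshold_tree X v)"
  using assms set_batch_subset[OF assms, of 1]
  by (auto simp: threshold_tree_def identify_tree_def Let_def intro!: queries_within_filter_tree)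

section \<open>Analysis of the two successive filterings\<close>

context
  fixes val :: "nat \<Rightarrow> real" and adv :: adversary and P :: "real \<Rightarrow> bool" and X :: "nat set"
    and f :: "nat set \<Rightarrow> nat set"
  assumes finX: "finite X"
begin

abbreviation (input) T :: "nat set" where
  "T \<equiv> target val P X"

lemma card_T_le: "card T \<le> card X"
  using finX by (intro card_mono) auto

lemma card_nonT_le: "card (X - T) \<le> card X"
  using finX by (intro card_mono) auto

text \<open>With price 1 per wrong survivor and per lost target element, any final set other than
  \<open>T\<close> costs at least 1, so the expected price bounds the error probability.\<close>

lemma second_filter_error_le:
  assumes "1 \<le> s"
  shows "tree_cost 1 0 0 (f T) val adv (filter_tree P (schedule L s) X (\<lambda>S. Output (f S))) h
    \<le> card X * (1/4) ^ L + 2 * card T * (1/4) ^ s"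
proof -
  have "tree_cost 1 0 0 (f T) val adv (filter_tree P (schedule L s) X (\<lambda>S. Output (f S))) h
    \<le> 0 + false_price 0 1 (schedule L s) * card (X - T)
        + 1 * (card (T - X) + card T * (\<Sum>i\<leftarrow>schedule L s. (1/4) ^ i))
        + 60 * 0 * real (card T) * real (sum_list (schedule L s)) + 0 * real (length (schedule L s))"
  proof (rule tree_cost_filter_tree_le[OF finX])
    fix S h assume S: "S \<subseteq> X"
    have "1 \<le> card (S - T) + card (T - S)" if "S \<noteq> T"
    proof -
      have "S - T \<noteq> {} \<or> T - S \<noteq> {}" using that by blast
      moreover have "finite (S - T)" "finite (T - S)" using S finX by (auto intro: finite_subset)
      ultimately have "card (S - T) \<noteq> 0 \<or> card (T - S) \<noteq> 0" using card_0_eq by blast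
      thus ?thesis by linarith
    qed
    thus "tree_cost 1 0 0 (f T) val adv (Output (f S)) h
        \<le> 0 + 1 * real (card (S - T)) + 1 * real (card (T - S))"
      by (cases "S = T") auto
  qed auto
  moreover have "false_price 0 1 (schedule L s) * card (X - T) \<le> (1/4) ^ L * card X"
    using false_price_schedule_le[of 0 1 s L] assms card_nonT_le by (intro mult_mono) auto
  moreover have "card T * (\<Sum>i\<leftarrow>schedule L s. (1/4) ^ i) \<le> card T * (2 * (1/4::real) ^ s)"
    by (intro mult_left_mono sum_list_quarter_power_schedule_le) auto
  moreover have "T - X = {}" by auto
  ultimately show ?thesis by (simp add: algebra_simps)
qed

text \<open>A wrong candidate costs 60 (s + 1) and a target element 60 (3 L + s); bounding both
  counts by n in the parts with \<open>s\<close> yields the factor 2 s + 1.\<close>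

lemma second_filter_queries_le:
  assumes "1 \<le> s"
  shows "tree_cost 0 1 0 G val adv (filter_tree P (schedule L s) X (\<lambda>S. Output (f S))) h
    \<le> 60 * ((2 * real s + 1) * real (card X) + 3 * real (card T) * real L)"
proof -
  have "tree_cost 0 1 0 G val adv (filter_tree P (schedule L s) X (\<lambda>S. Output (f S))) h
    \<le> 0 + false_price 1 0 (schedule L s) * card (X - T)
        + 0 * (real (card (T - X)) + card T * (\<Sum>i\<leftarrow>schedule L s. (1/4) ^ i))
        + 60 * 1 * real (card T) * real (sum_list (schedule L s)) + 0 * real (length (schedule L s))"
    by (rule tree_cost_filter_tree_le[OF finX]) auto
  moreover have "false_price 1 0 (schedule L s) * card (X - T) \<le> (60 * (real s + 1)) * real (card X)"
    using false_price_schedule_le[of 1 0 s L] assms card_nonT_le by (intro mult_mono) auto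
  moreover have "card T * real (sum_list (schedule L s)) \<le> card T * real (3 * L + s)"
    using sum_list_schedule_le[OF assms, of L] by (intro mult_left_mono) (simp_all only: of_nat_le_iff of_nat_0_le_iff)
  moreover have "card T * real s \<le> card X * real s"
    using card_T_le by (intro mult_right_mono) auto
  ultimately show ?thesis by (simp add: algebra_simps)
qed

lemma card_mult_quarter_power_le: "card X * (1/4::real) ^ (lg (card X) + 2) \<le> 1/16"
proof -
  have "real (card X) \<le> 2 ^ lg (card X)"
    using less_two_power_lg[of "card X"]
    by (metis less_imp_le_nat of_nat_le_iff of_nat_numeral of_nat_power)
  also have "\<dots> \<le> 4 ^ lg (card X)" by (intro power_mono) auto
  finally show ?thesis by (simp add: power_add power_divide field_simps)
qed

text \<open>
  If the first filter loses less than half of the target then the second one starts with enough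
  repetitions for a union bound over the target. The losses of the first filter enter linearly,
  as in Markov's inequality, through \<open>D = 2 / card T\<close>.
\<close>

lemma identify_tree_error_le:
  "tree_cost 1 0 0 (f T) val adv (identify_tree P (lg (card X) + 2) X (\<lambda>S. Output (f S))) h \<le> 1/3"
proof -
  let ?L = "lg (card X) + 2"
  have "tree_cost 1 0 0 (f T) val adv (identify_tree P ?L X (\<lambda>S. Output (f S))) h
    \<le> (card X * (1/4) ^ ?L + 1/16) + false_price 0 0 (schedule ?L 3) * card (X - T)
        + 2 / card T * (card (T - X) + card T * (\<Sum>i\<leftarrow>schedule ?L 3. (1/4) ^ i))
        + 60 * 0 * real (card T) * real (sum_list (schedule ?L 3)) + 0 * real (length (schedule ?L 3))"
    unfolding identify_tree_def
  proof (rule tree_cost_filter_tree_le[OF finX])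
    fix S h assume S: "S \<subseteq> X"
    let ?t = "filter_tree P (schedule ?L (3 + lg (card S))) X (\<lambda>S. Output (f S))"
    have finS: "finite S" using S finX finite_subset by blast
    have le: "tree_cost 1 0 0 (f T) val adv ?t h \<le> card X * (1/4) ^ ?L + 2 * card T * (1/4) ^ (3 + lg (card S))"
      by (rule second_filter_error_le) simp
    show "tree_cost 1 0 0 (f T) val adv ?t h
      \<le> (card X * (1/4) ^ ?L + 1/16) + 0 * real (card (S - T)) + 2 / card T * card (T - S)"
    proof (cases "card T \<le> 2 * card (T - S)")
      case True
      show ?thesis
      \<comment> \<open>For an empty target \<open>2 / card T\<close> is 0; the second filtering
        then has nothing to lose and its own bound suffices.\<close>
      proof (cases "card T = 0")
        case True
        show ?thesis using le unfolding True by simp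
      next
        case False
        hence "1 \<le> 2 / card T * card (T - S)" using True by (simp add: field_simps)
        moreover have "0 \<le> card X * (1/4::real) ^ ?L" by simp
        ultimately show ?thesis using tree_cost_error_le_1[of "f T" val adv ?t h] by linarith
      qed
    next
      case False
      have "card T \<le> card ((T - S) \<union> S)" using finX finS by (intro card_mono) auto
      also have "\<dots> \<le> card (T - S) + card S" by (rule card_Un_le)
      finally have "card T \<le> 2 * card S" using False by linarith
      also have "\<dots> \<le> 2 * 2 ^ lg (card S)" using less_two_power_lg[of "card S"] by simp
      finally have "real (card T) \<le> real (2 * 2 ^ lg (card S))" by (rule of_nat_mono)
      also have "\<dots> \<le> 2 * 4 ^ lg (card S)" by (simp add: power_mono)
      \<comment> \<open>The offset 3 in the starting value contributes the factor 1/64 against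
        \<open>2 * card T \<le> 4 * 4 ^ lg (card S)\<close>.\<close>
      finally have "2 * card T * (1/4::real) ^ (3 + lg (card S)) \<le> 1/16"
        by (simp add: power_add power_divide field_simps)
      moreover have "0 \<le> 2 / real (card T) * card (T - S)" by simp
      ultimately show ?thesis using le by linarith
    qed
  qed auto
  moreover have "false_price 0 0 (schedule ?L 3) * card (X - T) \<le> 0"
    using false_price_schedule_le[of 0 0 3 ?L] by (simp add: mult_nonpos_nonneg)
  moreover have "2 / card T * (card (T - X) + card T * (\<Sum>i\<leftarrow>schedule ?L 3. (1/4) ^ i)) \<le> 1/16"
  proof -
    have none: "card (T - X) = 0" by (subst Diff_eq_empty_iff[THEN iffD2]) auto
    have sum: "(\<Sum>i\<leftarrow>schedule ?L 3. (1/4::real) ^ i) \<le> 1/32"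
      using sum_list_quarter_power_schedule_le[of ?L 3] by (simp add: power3_eq_cube)
    show ?thesis
    proof (cases "card T = 0")
      case True
      show ?thesis unfolding True by simp
    next
      case False
      hence "2 / card T * (card (T - X) + card T * (\<Sum>i\<leftarrow>schedule ?L 3. (1/4) ^ i))
          = 2 * (\<Sum>i\<leftarrow>schedule ?L 3. (1/4) ^ i)"
        unfolding none by simp
      thus ?thesis using sum by linarith
    qed
  qed
  \<comment> \<open>Three contributions of at most 1/16: wrong final survivors, target elements lost
    after a good size estimate, and a bad estimate.\<close>
  ultimately show ?thesis using card_mult_quarter_power_le by linarith
qed

text \<open>Each wrong survivor of the first filtering raises the starting value of the second by at
  most one, which costs at most 120 n queries. This is the price \<open>B\<close>, and the factor
  4^-L makes it harmless.\<close>

lemma identify_tree_queries_le: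
  "tree_cost 0 1 0 G val adv (identify_tree P (lg (card X) + 2) X (\<lambda>S. Output (f S))) h
    \<le> 2520 * (card X + card X * log 2 (max 1 (real (card T))))"
proof -
  let ?L = "lg (card X) + 2"
  let ?n = "real (card X)"
  let ?k = "real (card T)"
  let ?A = "60 * ((7 + 2 * lg (card T)) * ?n + 3 * ?k * ?L)"
  have "tree_cost 0 1 0 G val adv (identify_tree P ?L X (\<lambda>S. Output (f S))) h
    \<le> ?A + false_price 1 (120 * ?n) (schedule ?L 3) * card (X - T)
        + 0 * (real (card (T - X)) + card T * (\<Sum>i\<leftarrow>schedule ?L 3. (1/4) ^ i))
        + 60 * 1 * real (card T) * real (sum_list (schedule ?L 3)) + 0 * real (length (schedule ?L 3))"
    unfolding identify_tree_def
  proof (rule tree_cost_filter_tree_le[OF finX])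
    fix S h assume S: "S \<subseteq> X"
    let ?t = "filter_tree P (schedule ?L (3 + lg (card S))) X (\<lambda>S. Output (f S))"
    have finS: "finite S" using S finX finite_subset by blast
    have "card S \<le> card (T \<union> (S - T))" using finX finS by (intro card_mono) auto
    also have "\<dots> \<le> card T + card (S - T)" by (rule card_Un_le)
    finally have "lg (card S) \<le> lg (card T + card (S - T))" by (rule lg_mono)
    also have "\<dots> \<le> lg (card T) + card (S - T)" by (rule lg_add_le)
    finally have "real (lg (card S)) \<le> lg (card T) + real (card (S - T))" by linarith
    hence "lg (card S) * ?n \<le> (lg (card T) + real (card (S - T))) * ?n"
      by (intro mult_right_mono) auto
    moreover have "tree_cost 0 1 0 G val adv ?t h
        \<le> 60 * ((2 * real (3 + lg (card S)) + 1) * ?n + 3 * ?k * real ?L)"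
      by (rule second_filter_queries_le) simp
    ultimately show "tree_cost 0 1 0 G val adv ?t h
      \<le> ?A + 120 * ?n * card (S - T) + 0 * real (card (T - S))"
      by (simp add: algebra_simps)
  qed auto
  moreover have "false_price 1 (120 * ?n) (schedule ?L 3) * card (X - T) \<le> 360 * ?n"
  proof (rule mult_mono)
    \<comment> \<open>The schedule contributes 60 (3 + 1) = 240 and the surviving part of
      \<open>B\<close> at most 120/16.\<close>
    show "false_price 1 (120 * ?n) (schedule ?L 3) \<le> 360"
      using false_price_schedule_le[of 1 "120 * ?n" 3 ?L] card_mult_quarter_power_le by simp
  qed (use card_nonT_le in auto)
  moreover have "?k * real (sum_list (schedule ?L 3)) \<le> ?k * real (3 * ?L + 3)"
    using sum_list_schedule_le[of 3 ?L] by (intro mult_left_mono) (simp_all only: of_nat_le_iff of_nat_0_le_iff)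
  moreover have "?k * lg (card X) \<le> 2 * ?n + ?n * log 2 (max 1 ?k)"
    by (rule mult_lg_le[OF card_T_le])
  moreover have "?n * lg (card T) \<le> ?n * (1 + log 2 (max 1 ?k))"
    by (intro mult_left_mono lg_le_log) auto
  moreover have "?k \<le> ?n" using card_T_le by simp
  \<comment> \<open>With k the target size, the terms are 780 n + 900 k + 120 n lg k + 360 k lg n;
    replacing the last two by their bounds adds 120 n + 720 n and gives 480 times n log k.\<close>
  ultimately have "tree_cost 0 1 0 G val adv (identify_tree P ?L X (\<lambda>S. Output (f S))) h
      \<le> 2520 * ?n + 480 * (?n * log 2 (max 1 ?k))"
    by (simp add: algebra_simps)
  moreover have "0 \<le> ?n * log 2 (max 1 ?k)" by simp
  ultimately show ?thesis by (simp only: distrib_left)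
qed

lemma identify_tree_rounds_le:
  "tree_cost 0 0 1 G val adv (identify_tree P (lg (card X) + 2) X (\<lambda>S. Output (f S))) h
    \<le> 2 * (real (log2_star (card X)) + 1)"
proof -
  let ?L = "lg (card X) + 2"
  have L: "?L \<le> card X + 3"
    using lg_le[of "card X" "card X"] by simp
  have step: "tree_cost 0 0 1 G val adv (filter_tree P (schedule ?L s) X out) h
      \<le> A + (real (log2_star (card X)) + 1)"
    if "3 \<le> s" "\<And>S h. S \<subseteq> X \<Longrightarrow> tree_cost 0 0 1 G val adv (out S) h \<le> A" for s out A h
  proof -
    have "tree_cost 0 0 1 G val adv (filter_tree P (schedule ?L s) X out) h
      \<le> A + false_price 0 0 (schedule ?L s) * card (X - T)
        + 0 * (real (card (T - X)) + card T * (\<Sum>i\<leftarrow>schedule ?L s. (1/4) ^ i))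
        + 60 * 0 * real (card T) * real (sum_list (schedule ?L s)) + 1 * real (length (schedule ?L s))"
      by (rule tree_cost_filter_tree_le[OF finX]) (use that in auto)
    moreover have "false_price 0 0 (schedule ?L s) * card (X - T) \<le> 0"
      using false_price_schedule_le[of 0 0 s ?L] that by (simp add: mult_nonpos_nonneg)
    moreover have "real (length (schedule ?L s)) \<le> real (log2_star (card X)) + 1"
      using length_schedule_le_log2_star[OF L that(1)] by simp
    ultimately show ?thesis by simp
  qed
  show ?thesis unfolding identify_tree_def
    by (rule order_trans[OF step[of 3 _ "0 + (real (log2_star (card X)) + 1)"]]) (auto intro!: step[of _ _ 0, simplified])
qed

end

section \<open>The initial guess of the minority side\<close>

context
  fixes val :: "nat \<Rightarrow> real" and adv :: adversary and X :: "nat set" and v :: real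
  assumes finX: "finite X" and nonempty: "X \<noteq> {}"
begin

abbreviation (input) side :: "bool \<Rightarrow> nat set" where
  "side b \<equiv> {x \<in> X. (v \<le> val x) = b}"

abbreviation (input) minority_guess :: "bool list \<Rightarrow> bool" where
  "minority_guess cs \<equiv> card {j. j < length (batch 1 X) \<and>
     v \<le> noisy_answers val adv [] (batch 1 X) cs ! j} < 30 * card X"

lemma side_True: "side True = at_least X val v"
  by (simp add: at_least_def)

lemma card_side_False: "card (side False) = card X - card (at_least X val v)"
proof -
  have "side False = X - at_least X val v" by (auto simp: at_least_def)
  thus ?thesis using finX by (simp add: card_Diff_subset at_least_def)
qed

lemma card_pos: "1 \<le> card X"
  using finX nonempty by (simp add: Suc_leI card_gt_0_iff)

lemma tree_cost_threshold_tree_le: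
  assumes "\<And>b h. tree_cost \<alpha> \<beta> \<gamma> (at_least X val v) val adv
      (identify_tree (\<lambda>a. (v \<le> a) = b) (lg (card X) + 2) X (\<lambda>S. Output (if b then S else X - S))) h
    \<le> u b"
  shows "tree_cost \<alpha> \<beta> \<gamma> (at_least X val v) val adv (threshold_tree X v) []
    \<le> \<beta> * (60 * card X) + \<gamma> + coin_mean (length (batch 1 X)) (\<lambda>cs. u (minority_guess cs))"
  using nonempty assms
  by (auto simp: threshold_tree_def Let_def length_batch[OF finX] intro!: coin_mean_mono)

text \<open>Either guess leads to the right answer with the same guarantee, since identifying one
  side determines the other; the guess influences only the cost.\<close>

lemma threshold_tree_error_le:
  "tree_cost 1 0 0 (at_least X val v) val adv (threshold_tree X v) [] \<le> 1/3"
proof -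
  have "tree_cost 1 0 0 (at_least X val v) val adv
      (identify_tree (\<lambda>a. (v \<le> a) = b) (lg (card X) + 2) X (\<lambda>S. Output (if b then S else X - S))) h
    \<le> 1/3" for b h
  proof -
    have "(if b then side b else X - side b) = at_least X val v" by (auto simp: at_least_def)
    thus ?thesis
      using identify_tree_error_le[OF finX, where f = "\<lambda>S. if b then S else X - S" and val = val
        and P = "\<lambda>a. (v \<le> a) = b" and adv = adv and h = h]
      by simp
  qed
  from tree_cost_threshold_tree_le[OF this] show ?thesis by simp
qed

text \<open>One round for the guess plus 2 (l + 1) for the filterings, where l = log* n is at least
  1 for nonempty \<open>X\<close>, so 2 l + 3 \<le> 5 l.\<close>

lemma threshold_tree_rounds_le:
  "tree_cost 0 0 1 (at_least X val v) val adv (threshold_tree X v) [] \<le> 5 * log2_star (card X)"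
proof -
  have "log2_star (card X) \<noteq> 0"
    using iterated_log_log2_star_le_0[of "card X"] card_pos by (intro notI) simp
  moreover note tree_cost_threshold_tree_le[OF identify_tree_rounds_le[OF finX]]
  ultimately show ?thesis by (simp add: order_trans)
qed

text \<open>The small side accounts for at most 60 n / 20 = 3 n positions. Together with fewer than
  27 n false coins this stays below 30 n, half of the batch.\<close>

lemma minority_guess_correct:
  assumes few: "lies cs {..<length (batch 1 X)} < 27 * card X"
    and small: "20 * card (side b) \<le> card X"
  shows "minority_guess cs = b"
proof -
  let ?N = "length (batch 1 X)"
  let ?as = "noisy_answers val adv [] (batch 1 X) cs"
  let ?F = "{j \<in> {..<?N}. \<not> cs ! j}"
  let ?V = "{j. j < ?N \<and> v \<le> ?as ! j}"
  let ?W = "{j. j < ?N \<and> v \<le> val (batch 1 X ! j)}"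
  have W: "card ?W = 60 * card (side True)"
    using card_batch_positions[OF finX, of 1 "\<lambda>x. v \<le> val x"] by simp
  have F: "card ?F < 27 * card X" using few by (simp add: lies_def)
  have VW: "?V \<subseteq> ?W \<union> ?F" "?W \<subseteq> ?V \<union> ?F" by (auto simp: nth_noisy_answers split: if_splits)
  have fin: "finite ?V" "finite ?W" "finite ?F" by auto
  have 1: "card ?V \<le> card ?W + card ?F" "card ?W \<le> card ?V + card ?F"
    using VW fin by (meson card_Un_le card_mono finite_UnI order_trans)+
  show ?thesis
  proof (cases b)
    case True
    thus ?thesis using small 1 W F by simp
  next
    case False
    hence "20 * (card X - card (side True)) \<le> card X"
      using small card_side_False by (simp add: at_least_def)
    thus ?thesis using False 1 W F by simp
  qed
qed

text \<open>Because 20 \<le> 2^5. In this balanced case log n and log m agree up to a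
  constant.\<close>

lemma log_card_le_log_minority:
  assumes "card X < 20 * m"
  shows "log 2 (card X) \<le> 5 + log 2 (max 1 (real m))"
proof -
  have "real (card X) \<le> 2 ^ 5 * max 1 (real m)" using assms by simp
  hence "log 2 (card X) \<le> log 2 (2 ^ 5 * max 1 (real m))" using card_pos by (subst log_le_cancel_iff) auto
  also have "\<dots> = 5 + log 2 (max 1 (real m))" using log_pow_cancel[of 2 5] by (subst log_mult) auto
  finally show ?thesis .
qed

text \<open>In the balanced case any guess is affordable, since n log n is O(n + n log m). Otherwise
  a wrong guess has probability at most 4^-n, so its cost of order n + n log n adds only O(n) to the
  expectation.\<close>

lemma threshold_tree_queries_le:
  defines "m \<equiv> min (card (at_least X val v)) (card X - card (at_least X val v))"
  shows "tree_cost 0 1 0 (at_least X val v) val adv (threshold_tree X v) []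
    \<le> 16000 * (card X + card X * log 2 (max 1 (real m)))"
proof -
  let ?n = "real (card X)"
  let ?N = "length (batch 1 X)"
  let ?u = "\<lambda>b. 2520 * (?n + ?n * log 2 (max 1 (real (card (side b)))))"
  let ?q = "?n * log 2 (max 1 (real m))"
  have q0: "0 \<le> ?q" by simp
  obtain b where b: "card (side b) = m"
  proof (cases "card (at_least X val v) \<le> card X - card (at_least X val v)")
    case True
    hence "card (side True) = m" by (simp only: side_True m_def min_def if_True)
    thus ?thesis by (rule that)
  next
    case False
    hence "card (side False) = m" by (simp only: card_side_False m_def min_def if_False)
    thus ?thesis by (rule that)
  qed
  have log_side: "log 2 (max 1 (real (card (side c)))) \<le> log 2 ?n" for c
  proof -
    have "card (side c) \<le> card X" using finX by (intro card_mono) auto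
    thus ?thesis using card_pos by (subst log_le_cancel_iff) auto
  qed
  have u_le: "?u c \<le> 2520 * (?n + ?n * log 2 ?n)" for c
    using log_side by (intro mult_left_mono add_left_mono) auto
  have cost: "tree_cost 0 1 0 (at_least X val v) val adv (threshold_tree X v) []
    \<le> 60 * ?n + coin_mean ?N (\<lambda>cs. ?u (minority_guess cs))"
    using tree_cost_threshold_tree_le[OF identify_tree_queries_le[OF finX]] by simp
  show ?thesis
  proof (cases "card X < 20 * m")
    case True
    have "coin_mean ?N (\<lambda>cs. ?u (minority_guess cs)) \<le> coin_mean ?N (\<lambda>_. 2520 * (?n + ?n * log 2 ?n))"
      by (rule coin_mean_mono) (rule u_le)
    moreover have "?n * log 2 ?n \<le> ?n * (5 + log 2 (max 1 (real m)))"
      using log_card_le_log_minority[OF True] by (intro mult_left_mono) auto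
    ultimately have "coin_mean ?N (\<lambda>cs. ?u (minority_guess cs)) \<le> 15120 * ?n + 2520 * ?q"
      by (simp add: algebra_simps)
    thus ?thesis using cost q0 by (simp only: distrib_left)
  next
    case False
    let ?bad = "\<lambda>cs. 27 * card X \<le> lies cs {..<?N}"
    let ?U = "2520 * (?n + ?n * log 2 ?n)"
    have "0 \<le> log 2 ?n" using card_pos by simp
    hence U0: "0 \<le> ?U" by simp
    have u0: "0 \<le> ?u b" by simp
    have "coin_mean ?N (\<lambda>cs. ?u (minority_guess cs)) \<le> coin_mean ?N (\<lambda>cs. ?u b + ?U * of_bool (?bad cs))"
    proof (rule coin_mean_mono)
      fix cs :: "bool list"
      show "?u (minority_guess cs) \<le> ?u b + ?U * of_bool (?bad cs)"
      proof (cases "?bad cs")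
        case True
        have "?u (minority_guess cs) \<le> ?u b + ?U" using u_le[of "minority_guess cs"] u0 by linarith
        thus ?thesis using True by (simp only: of_bool_eq mult_1_right)
      next
        case good: False
        hence "minority_guess cs = b" using False b by (intro minority_guess_correct) auto
        thus ?thesis using good by simp
      qed
    qed
    also have "\<dots> = ?u b + ?U * coin_mean ?N (\<lambda>cs. of_bool (?bad cs))"
      by (simp only: coin_mean_add coin_mean_cmult coin_mean_const)
    \<comment> \<open>The whole batch has 60 n positions, so the tail bound applies with s =
      n.\<close>
    also have "\<dots> \<le> ?u b + ?U * (1/4) ^ card X"
      using U0 by (intro add_left_mono mult_left_mono many_lies_unlikely) (auto simp: length_batch[OF finX])
    also have "?U * (1/4) ^ card X \<le> 2520 * ?n"
    proof -
      have "log 2 ?n \<le> ?n" using card_pos by (intro log2_le_self) simp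
      moreover have "1 + ?n \<le> 4 ^ card X"
      proof -
        have "Suc (card X) \<le> 2 ^ card X" by (simp add: Suc_leI)
        hence "1 + ?n \<le> 2 ^ card X" by (metis of_nat_Suc of_nat_le_iff of_nat_numeral of_nat_power add.commute)
        also have "\<dots> \<le> (4::real) ^ card X" by (intro power_mono) auto
        finally show ?thesis .
      qed
      ultimately have "(1 + log 2 ?n) * (1/4) ^ card X \<le> 4 ^ card X * (1/4) ^ card X"
        by (intro mult_right_mono) auto
      hence "(1 + log 2 ?n) * (1/4) ^ card X \<le> 1" by (simp flip: power_mult_distrib)
      hence "2520 * ?n * ((1 + log 2 ?n) * (1/4) ^ card X) \<le> 2520 * ?n * 1"
        by (intro mult_left_mono) auto
      thus ?thesis by (simp add: algebra_simps)
    qed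
    finally have "coin_mean ?N (\<lambda>cs. ?u (minority_guess cs)) \<le> 5040 * ?n + 2520 * ?q"
      unfolding b by (simp add: algebra_simps)
    thus ?thesis using cost q0 by (simp only: distrib_left)
  qed
qed

end

section \<open>From tree costs to probabilities and expectations of runs\<close>

lemma run_alg_return_pmf: "run_alg val adv (return_pmf t) = run_tree val adv t []"
  by (simp add: run_alg_def bind_return_pmf)

lemma prob_result_ge:
  "1 - tree_cost 1 0 0 G val adv t [] \<le>
    measure_pmf.prob (run_tree val adv t []) {r. result r = G}"
proof -
  let ?R = "run_tree val adv t []"
  have "emeasure (measure_pmf ?R) {r. result r \<noteq> G} = (\<integral>\<^sup>+r. indicator {r. result r \<noteq> G} r \<partial>measure_pmf ?R)"
    by simp
  also have "\<dots> = (\<integral>\<^sup>+r. ennreal (1 * of_bool (result r \<noteq> G) + 0 * num_queries r + 0 * num_rounds r) \<partial>measure_pmf ?R)"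
    by (intro nn_integral_cong) (auto simp: indicator_def)
  also have "\<dots> \<le> ennreal (tree_cost 1 0 0 G val adv t [])"
    using nn_integral_run_tree_le[where \<alpha> = 1 and \<beta> = 0 and \<gamma> = 0 and G = G and val = val and adv = adv
      and t = t and h = "[]"] by simp
  finally have "measure_pmf.prob ?R {r. result r \<noteq> G} \<le> tree_cost 1 0 0 G val adv t []"
    by (simp add: measure_pmf.emeasure_eq_measure tree_cost_nonneg)
  moreover have "measure_pmf.prob ?R {r. result r = G} = 1 - measure_pmf.prob ?R {r. result r \<noteq> G}"
    using measure_pmf.prob_compl[of "{r. result r \<noteq> G}" ?R]
    by (simp add: Compl_eq_Diff_UNIV[symmetric] Collect_neg_eq[symmetric])
  ultimately show ?thesis by linarith
qed

lemma expected_queries_le: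
  "expected_queries (run_tree val adv t []) \<le> ennreal (tree_cost 0 1 0 G val adv t [])"
  using nn_integral_run_tree_le[where \<alpha> = 0 and \<beta> = 1 and \<gamma> = 0 and G = G and val = val and adv = adv
      and t = t and h = "[]"]
  by (simp add: expected_queries_def ennreal_of_nat_eq_real_of_nat)

lemma expected_rounds_le:
  "expected_rounds (run_tree val adv t []) \<le> ennreal (tree_cost 0 0 1 G val adv t [])"
  using nn_integral_run_tree_le[where \<alpha> = 0 and \<beta> = 0 and \<gamma> = 1 and G = G and val = val and adv = adv
      and t = t and h = "[]"]
  by (simp add: expected_rounds_def ennreal_of_nat_eq_real_of_nat)

theorem mainTheorem4:
  "\<exists>(threshold_alg :: nat set \<Rightarrow> real \<Rightarrow> query_tree pmf) (C :: real). C > 0 \<and>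
     (\<forall>(X :: nat set) (v :: real). finite X \<longrightarrow>
       (\<forall>t \<in> set_pmf (threshold_alg X v). queries_within X t) \<and>
       (\<forall>(val :: nat \<Rightarrow> real) (adv :: adversary).
         let n = card X;
             k = card (at_least X val v);
             R = run_alg val adv (threshold_alg X v)
         in measure_pmf.prob R {r. result r = at_least X val v} \<ge> 2/3
          \<and> expected_queries R
              \<le> ennreal (C * (real n + real n * log 2 (max 1 (real (min k (n - k))))))
          \<and> expected_rounds R
              \<le> ennreal (C * (real (log2_star (real n)) *
                              max 1 (log 2 (log 2 (max 2 (real k))))))))"
proof (intro exI[of _ "\<lambda>X v. return_pmf (threshold_tree X v)"] exI[of _ 16000] conjI allI impI)
  \<comment> \<open>The witness is a point mass on a tree built from \<open>X\<close> and
    \<open>v\<close> alone, which makes it oblivious of \<open>val\<close>; 16000 comes from the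
    query bound.\<close>
  fix X :: "nat set" and v :: real and val :: "nat \<Rightarrow> real" and adv :: adversary
  assume fin: "finite X"
  let ?G = "at_least X val v"
  let ?R = "run_tree val adv (threshold_tree X v) []"
  have costs: "tree_cost 1 0 0 ?G val adv (threshold_tree X v) [] \<le> 1/3 \<and>
    tree_cost 0 1 0 ?G val adv (threshold_tree X v) []
      \<le> 16000 * (real (card X) + card X * log 2 (max 1 (real (min (card ?G) (card X - card ?G))))) \<and>
    tree_cost 0 0 1 ?G val adv (threshold_tree X v) [] \<le> 5 * log2_star (card X)"
  proof (cases "X = {}")
    case True
    thus ?thesis by (simp add: threshold_tree_def at_least_def)
  next
    case False
    thus ?thesis using threshold_tree_error_le threshold_tree_queries_le threshold_tree_rounds_le fin
      by auto
  qed
  \<comment> \<open>The log log factor is at least 1 through its \<open>max\<close>, so a bound of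
    order log* n is enough.\<close>
  have "real (log2_star (card X)) * 1
      \<le> log2_star (card X) * max 1 (log 2 (log 2 (max 2 (real (card ?G)))))"
    by (intro mult_left_mono) auto
  hence "5 * real (log2_star (card X))
      \<le> 16000 * (log2_star (card X) * max 1 (log 2 (log 2 (max 2 (real (card ?G))))))"
    by linarith
  hence "expected_rounds ?R
      \<le> ennreal (16000 * (log2_star (card X) * max 1 (log 2 (log 2 (max 2 (real (card ?G)))))))"
    using costs by (intro order_trans[OF expected_rounds_le[of _ _ _ ?G]] ennreal_leI) linarith
  moreover have "2/3 \<le> measure_pmf.prob ?R {r. result r = ?G}"
    using prob_result_ge[of ?G val adv "threshold_tree X v"] costs by linarith
  moreover have "expected_queries ?R
      \<le> ennreal (16000 * (real (card X) + card X * log 2 (max 1 (real (min (card ?G) (card X - card ?G))))))"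
    using costs by (intro order_trans[OF expected_queries_le[of _ _ _ ?G]] ennreal_leI) blast
  ultimately show "let n = card X; k = card ?G; R = run_alg val adv (return_pmf (threshold_tree X v))
      in measure_pmf.prob R {r. result r = ?G} \<ge> 2/3
       \<and> expected_queries R \<le> ennreal (16000 * (real n + real n * log 2 (max 1 (real (min k (n - k))))))
       \<and> expected_rounds R \<le> ennreal (16000 * (real (log2_star (real n)) *
                              max 1 (log 2 (log 2 (max 2 (real k))))))"
    unfolding Let_def run_alg_return_pmf by blast
qed (auto simp: queries_within_threshold_tree)

end
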